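(* Let $q(x,y) = a x^2 + b x y + c y^2 + d x + e y + f \in \mathbb{Z}[x,y]$ be such that $\mathrm{Det}(q)$ and $\mathrm{Disc}(q)$ are both nonzero, and let $\mathcal{C}(q) = \{(x,y) \in \mathbb{Q}^2 : q(x,y) = 0\}$. Assume that $\mathcal{C}(q)$ is nonempty, i.e. the curve $q(x,y)=0$ has at least one rational point. Then there is a map $(P,Q,R) \mapsto P \cdot Q^* \cdot R$ defined for $P,Q,R \in \mathcal{C}(q)$ such that, for all $P,Q,R,S,T \in \mathcal{C}(q)$: (1) (Multiplication) $P \cdot Q^* \cdot R \in \mathcal{C}(q)$; (2) (Commutativity) $P \cdot Q^* \cdot R = R \cdot Q^* \cdot P$; (3) (Associativity) $(P \cdot Q^* \cdot R) \cdot S^* \cdot T = P \cdot Q^* \cdot (R \cdot S^* \cdot T)$; and there exist $Q_0, R_0 \in \mathcal{C}(q)$ such that (4) (Identity) $P \cdot Q_0^* \cdot R_0 = P$ for all $P \in \mathcal{C}(q)$; (5) (Inverses) for every $P \in \mathcal{C}(q)$ there is $R \in \mathcal{C}(q)$ such that $P \cdot Q_0^* \cdot R = R_0$.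
   Context: For $q(x,y) = a x^2 + b x y + c y^2 + d x + e y + f$, $$\mathrm{Det}(q) = \begin{vmatrix} a & b/2 & d/2 \\ b/2 & c & e/2 \\ d/2 & e/2 & f \end{vmatrix}, \qquad \mathrm{Disc}(q) = \begin{vmatrix} a & b/2 \\ b/2 & c \end{vmatrix}.$$ The notation $P \cdot Q^* \cdot R$ is just notation for a ternary operation; $Q^*$ has no separate meaning. *)

theory Defs
  imports "HOL-Analysis.Determinants"
begin

text \<open>
  A polynomial $a x^2 + b x y + c y^2 + d x + e y + f$ in $Z[x,y]$ is represented by its six
  integer coefficients. The matrices live over the rationals because of the halved entries.
\<close>

definition conic_eval :: "int \<Rightarrow> int \<Rightarrow> int \<Rightarrow> int \<Rightarrow> int \<Rightarrow> int \<Rightarrow> rat \<Rightarrow> rat \<Rightarrow> rat" where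
  "conic_eval a b c d e f x y =
     of_int a * x^2 + of_int b * x * y + of_int c * y^2 + of_int d * x + of_int e * y + of_int f"

definition conic_Det :: "int \<Rightarrow> int \<Rightarrow> int \<Rightarrow> int \<Rightarrow> int \<Rightarrow> int \<Rightarrow> rat" where
  "conic_Det a b c d e f =
     det (vector [vector [of_int a,     of_int b / 2, of_int d / 2],
                  vector [of_int b / 2, of_int c,     of_int e / 2],
                  vector [of_int d / 2, of_int e / 2, of_int f]] :: rat^3^3)"

definition conic_Disc :: "int \<Rightarrow> int \<Rightarrow> int \<Rightarrow> int \<Rightarrow> int \<Rightarrow> int \<Rightarrow> rat" where
  "conic_Disc a b c d e f =
     det (vector [vector [of_int a,     of_int b / 2],
                  vector [of_int b / 2, of_int c]] :: rat^2^2)"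

definition conic_curve :: "int \<Rightarrow> int \<Rightarrow> int \<Rightarrow> int \<Rightarrow> int \<Rightarrow> int \<Rightarrow> (rat \<times> rat) set" where
  "conic_curve a b c d e f = {(x, y). conic_eval a b c d e f x y = 0}"

end

theory Submission
  imports Defs
begin

text \<open>
  Since \<open>Disc \<noteq> 0\<close> the conic has a centre, and translating it to the origin turns the
  equation into \<open>N p = k\<close> for the binary quadratic form \<open>N = a x\<^sup>2 + b x y + c y\<^sup>2\<close>; here
  \<open>k \<noteq> 0\<close> because \<open>Det = - k * Disc\<close>. In the quadratic algebra whose norm is proportional to
  \<open>N\<close>, let \<open>p q\<^sup>* r\<close> be the suitably rescaled product with the
  conjugate of the middle factor. With the
  polar form \<open>B\<close> of \<open>N\<close>, adding the relations \<open>p q\<^sup>* r + q p\<^sup>* r = B p q r\<close> and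
  \<open>p q\<^sup>* r + p r\<^sup>* q = B q r p\<close> and subtracting \<open>q p\<^sup>* r + q r\<^sup>* p = B p r q\<close> gives
  \<open>2 p q\<^sup>* r = B p q r + B q r p - B p r q\<close>, a formula that does not mention the algebra.
  Divided by \<open>2 k\<close>, it is the required operation on the curve \<open>N p = k\<close>.
\<close>

definition quad_form :: "'a::field \<Rightarrow> 'a \<Rightarrow> 'a \<Rightarrow> 'a \<times> 'a \<Rightarrow> 'a" where
  "quad_form a b c p = a * (fst p)^2 + b * fst p * snd p + c * (snd p)^2"

definition polar_form :: "'a::field \<Rightarrow> 'a \<Rightarrow> 'a \<Rightarrow> 'a \<times> 'a \<Rightarrow> 'a \<times> 'a \<Rightarrow> 'a" where
  "polar_form a b c p q =
     2 * a * fst p * fst q + b * (fst p * snd q + snd p * fst q) + 2 * c * snd p * snd q"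

text \<open>This is twice the product \<open>p q^* r\<close>; dividing only in
  \<open>level_prod\<close> keeps the identities polynomial.\<close>

definition triple_prod ::
    "'a::field \<Rightarrow> 'a \<Rightarrow> 'a \<Rightarrow> 'a \<times> 'a \<Rightarrow> 'a \<times> 'a \<Rightarrow> 'a \<times> 'a \<Rightarrow> 'a \<times> 'a" where
  "triple_prod a b c p q r =
    (let B = polar_form a b c in
      (B p q * fst r + B q r * fst p - B p r * fst q,
       B p q * snd r + B q r * snd p - B p r * snd q))"

definition level_prod ::
    "'a::field \<Rightarrow> 'a \<Rightarrow> 'a \<Rightarrow> 'a \<Rightarrow> 'a \<times> 'a \<Rightarrow> 'a \<times> 'a \<Rightarrow> 'a \<times> 'a \<Rightarrow> 'a \<times> 'a" where
  "level_prod a b c k p q r =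
    (let t = triple_prod a b c p q r in (fst t / (2 * k), snd t / (2 * k)))"

lemma fst_triple_prod:
  "fst (triple_prod a b c p q r) = polar_form a b c p q * fst r + polar_form a b c q r * fst p -
     polar_form a b c p r * fst q"
  and snd_triple_prod:
  "snd (triple_prod a b c p q r) = polar_form a b c p q * snd r + polar_form a b c q r * snd p -
     polar_form a b c p r * snd q"
  by (simp_all add: triple_prod_def Let_def)

lemma polar_form_commute: "polar_form a b c p q = polar_form a b c q p"
  by (simp add: polar_form_def algebra_simps)

lemma polar_form_self: "polar_form a b c p p = 2 * quad_form a b c p"
  by (simp add: polar_form_def quad_form_def power2_eq_square algebra_simps)

lemma quad_form_combination:
  "quad_form a b c (x * fst p + y * fst q - z * fst r, x * snd p + y * snd q - z * snd r) =
     x^2 * quad_form a b c p + y^2 * quad_form a b c q + z^2 * quad_form a b c r +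
     x * y * polar_form a b c p q - x * z * polar_form a b c p r - y * z * polar_form a b c q r"
  by (simp add: polar_form_def quad_form_def power2_eq_square algebra_simps)

text \<open>Half the Gram determinant of three vectors, which vanishes in the plane.\<close>

lemma gram_det_eq_0:
  "4 * quad_form a b c p * quad_form a b c q * quad_form a b c r +
     polar_form a b c p q * polar_form a b c q r * polar_form a b c p r =
     (polar_form a b c p q)^2 * quad_form a b c r + (polar_form a b c q r)^2 * quad_form a b c p +
     (polar_form a b c p r)^2 * quad_form a b c q"
  unfolding polar_form_def quad_form_def by algebra

text \<open>Expansion leaves three squared terms minus the product of the three polar values, which
  \<open>gram_det_eq_0\<close> evaluates.\<close>

lemma quad_form_triple_prod:
  "quad_form a b c (triple_prod a b c p q r) =
     4 * quad_form a b c p * quad_form a b c q * quad_form a b c r"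
  using gram_det_eq_0[of a b c p q r]
  unfolding triple_prod_def Let_def quad_form_combination
  by (simp add: polar_form_commute[of a b c r] power2_eq_square algebra_simps)

text \<open>The matrix of polar values factors through the symmetric matrix of the polar form, of
  determinant \<open>4 * a * c - b^2\<close>; take determinants.\<close>

lemma polar_form_minor:
  "polar_form a b c p r * polar_form a b c q s - polar_form a b c p s * polar_form a b c q r =
     (4 * a * c - b^2) * (fst p * snd q - snd p * fst q) * (fst r * snd s - snd r * fst s)"
  by (simp add: polar_form_def power2_eq_square algebra_simps)

lemma polar_form_triple_prod:
  "polar_form a b c (triple_prod a b c p q r) s =
     polar_form a b c p q * polar_form a b c r s + polar_form a b c q r * polar_form a b c p s -
     polar_form a b c p r * polar_form a b c q s"
  by (simp add: polar_form_def[of a b c _ s] triple_prod_def Let_def algebra_simps)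

text \<open>
  After expanding both sides with \<open>polar_form_triple_prod\<close>, their difference is a combination
  of \<open>p, q, s, t\<close> with \<open>2 \<times> 2\<close> minors of the Gram matrix as coefficients. By
  \<open>polar_form_minor\<close> these factor into determinants of pairs of vectors, and the difference
  vanishes by the linear relation among any three vectors of the plane.
\<close>

lemma triple_prod_assoc:
  "triple_prod a b c (triple_prod a b c p q r) s t =
     triple_prod a b c p q (triple_prod a b c r s t)"
proof -
  let ?B = "polar_form a b c"
  define \<Delta> where "\<Delta> = 4 * a * c - b^2"
  define w where "w p q = fst p * snd q - snd p * fst q" for p q :: "'a \<times> 'a"
  have minor: "?B x u * ?B y v = ?B x v * ?B y u + \<Delta> * w x y * w u v" for x y u v
    using polar_form_minor[of a b c x u y v] by (simp add: \<Delta>_def w_def algebra_simps)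
  have flip: "?B x (triple_prod a b c r s t) = ?B r s * ?B x t + ?B s t * ?B x r - ?B r t * ?B x s"
    for x
    by (simp add: polar_form_commute[of a b c x] polar_form_triple_prod)
  \<comment> \<open>Each instance trades one product for the product subtracted next to it, leaving
    only a multiple of \<open>\<Delta>\<close>: \<open>m1\<close>, \<open>m2\<close> serve the left
    side, \<open>m3\<close>, \<open>m4\<close> the right.\<close>
  have m1: "?B q r * ?B p s = ?B q s * ?B p r + \<Delta> * w q p * w r s"
    and m2: "?B q r * ?B p t = ?B q t * ?B p r + \<Delta> * w q p * w r t"
    and m3: "?B r s * ?B q t = ?B r t * ?B q s + \<Delta> * w r q * w s t"
    and m4: "?B r s * ?B p t = ?B r t * ?B p s + \<Delta> * w r p * w s t"
    by (rule minor)+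
  have three: "w y z * fst x + w z x * fst y + w x y * fst z = 0"
    "w y z * snd x + w z x * snd y + w x y * snd z = 0" for x y z
    by (simp_all add: w_def algebra_simps)
  have anti: "w x y = - w y x" for x y
    by (simp add: w_def)
  \<comment> \<open>Here \<open>z\<close> stands for \<open>fst\<close> or \<open>snd\<close>, so
    both coordinates are treated at once.\<close>
  have key: "A = B" if "w s t * z r + w t r * z s + w r s * z t = 0"
    "w p q * z r + w q r * z p + w r p * z q = 0"
    "A = (?B p q * ?B r s + ?B q r * ?B p s - ?B p r * ?B q s) * z t +
      ?B s t * (?B p q * z r + ?B q r * z p - ?B p r * z q) -
      (?B p q * ?B r t + ?B q r * ?B p t - ?B p r * ?B q t) * z s"
    "B = ?B p q * (?B r s * z t + ?B s t * z r - ?B r t * z s) +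
      (?B r s * ?B q t + ?B s t * ?B q r - ?B r t * ?B q s) * z p -
      (?B r s * ?B p t + ?B s t * ?B p r - ?B r t * ?B p s) * z q"
    for A B and z :: "'a \<times> 'a \<Rightarrow> 'a"
  proof -
    have "A - B = \<Delta> * (w q p * (w r s * z t - w r t * z s) + w s t * (w r p * z q - w r q * z p))"
      unfolding that(3,4) m1 m2 m3 m4 by (simp add: algebra_simps)
    \<comment> \<open>The linear relations turn both brackets into multiples of \<open>z r\<close>,
      and the two terms then cancel.\<close>
    also have "w r s * z t - w r t * z s = - w s t * z r"
      using that(1) anti[of r t] by algebra
    also have "w r p * z q - w r q * z p = w q p * z r"
      using that(2) anti[of r q] anti[of q p] by algebra
    finally show ?thesis by simp
  qed
  show ?thesis
  proof (rule prod_eqI)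
    show "fst (triple_prod a b c (triple_prod a b c p q r) s t) =
        fst (triple_prod a b c p q (triple_prod a b c r s t))"
      by (rule key[of fst, OF three(1) three(1)])
        (simp_all only: fst_triple_prod polar_form_triple_prod flip)
    show "snd (triple_prod a b c (triple_prod a b c p q r) s t) =
        snd (triple_prod a b c p q (triple_prod a b c r s t))"
      by (rule key[of snd, OF three(2) three(2)])
        (simp_all only: snd_triple_prod polar_form_triple_prod flip)
  qed
qed

lemma triple_prod_scale_left:
  "triple_prod a b c (fst p / u, snd p / u) q r =
     (fst (triple_prod a b c p q r) / u, snd (triple_prod a b c p q r) / u)"
  by (simp add: triple_prod_def polar_form_def Let_def add_divide_distrib diff_divide_distrib
      algebra_simps)

lemma triple_prod_commute: "triple_prod a b c p q r = triple_prod a b c r q p"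
  by (simp add: triple_prod_def Let_def polar_form_commute[of _ _ _ q]
      polar_form_commute[of _ _ _ r p] algebra_simps)

lemma level_prod_commute: "level_prod a b c k p q r = level_prod a b c k r q p"
  unfolding level_prod_def by (subst triple_prod_commute) (rule refl)

lemma level_prod_assoc:
  "level_prod a b c k (level_prod a b c k p q r) s t =
     level_prod a b c k p q (level_prod a b c k r s t)"
proof -
  have "triple_prod a b c p q (fst r' / (2 * k), snd r' / (2 * k)) =
     (fst (triple_prod a b c p q r') / (2 * k), snd (triple_prod a b c p q r') / (2 * k))" for r'
    by (subst (1 2 3) triple_prod_commute) (rule triple_prod_scale_left)
  then show ?thesis
    by (simp add: level_prod_def Let_def triple_prod_scale_left triple_prod_assoc)
qed

text \<open>The divisor \<open>2 * k\<close> is chosen so that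
  \<open>4 * k^3 / (2 * k)^2 = k\<close>. For \<open>k = 0\<close>, division by zero gives the zero
  vector, where the form vanishes.\<close>

lemma quad_form_level_prod:
  fixes k :: "'a::field_char_0"
  assumes "quad_form a b c p = k" "quad_form a b c q = k" "quad_form a b c r = k"
  shows "quad_form a b c (level_prod a b c k p q r) = k"
proof (cases "k = 0")
  case False
  have "quad_form a b c (level_prod a b c k p q r) =
      quad_form a b c (triple_prod a b c p q r) / (2 * k)^2"
    by (simp add: level_prod_def quad_form_def Let_def power2_eq_square add_divide_distrib)
  also have "\<dots> = k"
    using False by (simp add: quad_form_triple_prod assms power2_eq_square)
  finally show ?thesis .
qed (simp add: level_prod_def quad_form_def)

text \<open>With two equal neighbouring arguments the mixed terms cancel, leaving
  \<open>2 * k\<close> times \<open>p\<close>. This yields the identity and the inverses.\<close>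

lemma level_prod_cancel:
  fixes k :: "'a::field_char_0"
  assumes "quad_form a b c q = k" "k \<noteq> 0"
  shows "level_prod a b c k p q q = p" "level_prod a b c k q q p = p"
proof -
  show "level_prod a b c k p q q = p"
    using assms by (simp add: level_prod_def triple_prod_def Let_def polar_form_self)
  then show "level_prod a b c k q q p = p"
    by (subst level_prod_commute)
qed

lemma conic_curve_centre:
  assumes "conic_Det a b c d e f \<noteq> 0" "conic_Disc a b c d e f \<noteq> 0"
  obtains h l k where "k \<noteq> 0"
    "\<And>p. p \<in> conic_curve a b c d e f \<longleftrightarrow>
       quad_form (of_int a) (of_int b) (of_int c) (fst p - h, snd p - l) = k"
proof -
  define A B C D E F :: rat where "A = of_int a" and "B = of_int b" and "C = of_int c"
    and "D = of_int d" and "E = of_int e" and "F = of_int f"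
  note defs = A_def B_def C_def D_def E_def F_def
  define \<Delta> where "\<Delta> = 4 * A * C - B^2"
  have "4 * conic_Disc a b c d e f = \<Delta>"
    by (simp add: conic_Disc_def det_2 \<Delta>_def defs power2_eq_square algebra_simps)
  with assms(2) have \<Delta>: "\<Delta> \<noteq> 0" by auto
  \<comment> \<open>Cramer's rule for the critical point of the polynomial, where both partial
    derivatives vanish.\<close>
  define h where "h = (B * E - 2 * C * D) / \<Delta>"
  define l where "l = (B * D - 2 * A * E) / \<Delta>"
  define k where "k = - conic_eval a b c d e f h l"
  have h: "h * \<Delta> = B * E - 2 * C * D" and l: "l * \<Delta> = B * D - 2 * A * E"
    using \<Delta> by (simp_all add: h_def l_def)
  have "\<Delta> * (2 * A * h + B * l + D) = 0" "\<Delta> * (B * h + 2 * C * l + E) = 0"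
    using h l unfolding \<Delta>_def by algebra+
  with \<Delta> have grad: "2 * A * h + B * l + D = 0" "B * h + 2 * C * l + E = 0"
    by simp_all
  have k: "k = - (A * h^2 + B * h * l + C * l^2 + D * h + E * l + F)"
    by (simp add: k_def conic_eval_def defs)
  have det: "4 * conic_Det a b c d e f = 4 * A * C * F + B * D * E - A * E^2 - B^2 * F - C * D^2"
    by (simp add: conic_Det_def det_3 defs power2_eq_square field_simps)
  \<comment> \<open>Translation to the centre preserves the determinant and makes the matrix block
    diagonal with last entry \<open>-k\<close>.\<close>
  have "4 * conic_Det a b c d e f = - k * \<Delta>"
    unfolding det k \<Delta>_def using grad by algebra
  with assms(1) have "k \<noteq> 0" by auto
  moreover have "p \<in> conic_curve a b c d e f \<longleftrightarrow>
       quad_form (of_int a) (of_int b) (of_int c) (fst p - h, snd p - l) = k" for p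
  proof -
    obtain x y where p: "p = (x, y)" by (cases p)
    \<comment> \<open>Taylor expansion at the critical point has no linear part.\<close>
    have "A * x^2 + B * x * y + C * y^2 + D * x + E * y + F =
        A * (x - h)^2 + B * (x - h) * (y - l) + C * (y - l)^2 - k"
      unfolding k using grad by algebra
    then show ?thesis
      by (simp add: p conic_curve_def conic_eval_def quad_form_def defs)
  qed
  ultimately show thesis by (rule that)
qed

theorem theorem3p1:
  fixes a b c d e f :: int
  assumes "conic_Det a b c d e f \<noteq> 0"
    and "conic_Disc a b c d e f \<noteq> 0"
    and "conic_curve a b c d e f \<noteq> {}"
  shows "\<exists>m :: rat \<times> rat \<Rightarrow> rat \<times> rat \<Rightarrow> rat \<times> rat \<Rightarrow> rat \<times> rat.
    (let C = conic_curve a b c d e f in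
      (\<forall>P\<in>C. \<forall>Q\<in>C. \<forall>R\<in>C. m P Q R \<in> C) \<and>
      (\<forall>P\<in>C. \<forall>Q\<in>C. \<forall>R\<in>C. m P Q R = m R Q P) \<and>
      (\<forall>P\<in>C. \<forall>Q\<in>C. \<forall>R\<in>C. \<forall>S\<in>C. \<forall>T\<in>C. m (m P Q R) S T = m P Q (m R S T)) \<and>
      (\<exists>Q0\<in>C. \<exists>R0\<in>C.
        (\<forall>P\<in>C. m P Q0 R0 = P) \<and>
        (\<forall>P\<in>C. \<exists>R\<in>C. m P Q0 R = R0)))"
proof -
  let ?C = "conic_curve a b c d e f"
  obtain h l k where k: "k \<noteq> 0" and C: "\<And>p. p \<in> ?C \<longleftrightarrow>
      quad_form (of_int a) (of_int b) (of_int c) (fst p - h, snd p - l) = k"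
    using conic_curve_centre[OF assms(1,2)] by metis
  define g where "g = level_prod (of_int a) (of_int b) (of_int c) k"
  define \<tau> where "\<tau> P = (fst P - h, snd P - l)" for P :: "rat \<times> rat"
  define \<sigma> where "\<sigma> p = (fst p + h, snd p + l)" for p :: "rat \<times> rat"
  define m where "m P Q R = \<sigma> (g (\<tau> P) (\<tau> Q) (\<tau> R))" for P Q R
  have [simp]: "\<tau> (\<sigma> p) = p" "\<sigma> (\<tau> p) = p" for p
    by (simp_all add: \<sigma>_def \<tau>_def)
  have C: "P \<in> ?C \<longleftrightarrow> quad_form (of_int a) (of_int b) (of_int c) (\<tau> P) = k" for P
    by (simp add: C \<tau>_def)
  have closed: "m P Q R \<in> ?C" if "P \<in> ?C" "Q \<in> ?C" "R \<in> ?C" for P Q R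
    using that by (simp add: C m_def g_def quad_form_level_prod)
  have commute: "m P Q R = m R Q P" for P Q R
    unfolding m_def g_def by (subst level_prod_commute) (rule refl)
  have assoc: "m (m P Q R) S T = m P Q (m R S T)" for P Q R S T
    by (simp add: m_def g_def level_prod_assoc)
  have cancel: "m P Q Q = P" "m Q Q P = P" if "Q \<in> ?C" for P Q
    using that k by (simp_all add: C m_def g_def level_prod_cancel)
  \<comment> \<open>Any point of the curve can serve as both \<open>Q0\<close> and
    \<open>R0\<close>.\<close>
  obtain O' where O': "O' \<in> ?C" using assms(3) by auto
  \<comment> \<open>Associativity gives \<open>m (m P O' O') P O'\<close>, which cancels to
    \<open>m P P O'\<close> and then to \<open>O'\<close>.\<close>
  have inv_eq: "m P O' (m O' P O') = O'" if "P \<in> ?C" for P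
    using that O' by (simp add: cancel flip: assoc)
  have inverse: "\<exists>R\<in>?C. m P O' R = O'" if "P \<in> ?C" for P
    using that O' closed inv_eq by (intro bexI[of _ "m O' P O'"])
  have unit: "\<exists>Q0\<in>?C. \<exists>R0\<in>?C. (\<forall>P\<in>?C. m P Q0 R0 = P) \<and>
      (\<forall>P\<in>?C. \<exists>R\<in>?C. m P Q0 R = R0)"
    by (intro bexI[OF _ O'] conjI ballI cancel(1)[OF O'] inverse)
  show ?thesis
    unfolding Let_def
    by (intro exI[of _ m] conjI unit ballI closed commute assoc)
qed

end
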